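(* Let $|\varphi\rangle,|\psi\rangle\in\mathcal{H}_2$ be unit vectors with orthogonal unit vectors $|\varphi^\perp\rangle,|\psi^\perp\rangle$, let $\mu,\nu\in[0,1]$, and let $\mathcal{M},\mathcal{N}$ be the noisy qubit measurements $$M_1=\mu|\varphi\rangle\langle\varphi|+\tfrac{1-\mu}{2}I,\quad M_2=\mu|\varphi^\perp\rangle\langle\varphi^\perp|+\tfrac{1-\mu}{2}I,$$ $$N_1=\nu|\psi\rangle\langle\psi|+\tfrac{1-\nu}{2}I,\quad N_2=\nu|\psi^\perp\rangle\langle\psi^\perp|+\tfrac{1-\nu}{2}I .$$ Let $\eta_{\mathcal M},\eta_{\mathcal N}\ge0$, $\eta_{\mathcal M}+\eta_{\mathcal N}=1$. Then the problem of discrimination with fixed failure rate $p_f$ of the measurements $\mathcal{M},\mathcal{N}$ with priors $\eta_{\mathcal M},\eta_{\mathcal N}$ is equivalent to discrimination with fixed failure rate $p_f$ of the two mixed states with density operators $M_1$ and $N_1$ with the same priors: for every $p_f\in[0,1]$ the maximal success probabilities of the two problems coincide, and an optimal test of the measurements is given by $H^{(c)}_1=\tfrac12E_c$, $H^{(c)}_2=\tfrac12(\mathrm{tr}[E_c]I-E_c)$, $c\in\{\mathcal M,\mathcal N,f\}$, where $\{E_{\mathcal M},E_{\mathcal N},E_f\}$ is an optimal POVM for the state discrimination problem.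
   Context: $\mathcal{H}_2$ is the two-dimensional complex Hilbert space. A (single-shot, general ancilla-assisted) test $\mathcal{T}$ of two-outcome qubit measurements with conclusions $c\in\{\mathcal{M},\mathcal{N},f\}$ ($f$ = inconclusive) is a family of positive semidefinite operators $H^{(c)}_j$ on $\mathcal{H}_2$, $j=1,2$, with $\sum_c H^{(c)}_j=\rho$ for $j=1,2$, where $\rho\ge0$, $\mathrm{tr}[\rho]=1$ is independent of $j$. The probability of conclusion $c$ when the tested measurement has POVM $\{A_1,A_2\}$ is $p(c|\mathcal{A},\mathcal{T})=\sum_j \mathrm{tr}[H^{(c)}_jA_j]$; $p_s=\eta_{\mathcal M}p(\mathcal M|\mathcal M,\mathcal T)+\eta_{\mathcal N}p(\mathcal N|\mathcal N,\mathcal T)$ and $p_f=\eta_{\mathcal M}p(f|\mathcal M,\mathcal T)+\eta_{\mathcal N}p(f|\mathcal N,\mathcal T)$. For discrimination of the density operators $M_1$ (prior $\eta_{\mathcal M}$) and $N_1$ (prior $\eta_{\mathcal N}$) by a POVM $\{E_{\mathcal M},E_{\mathcal N},E_f\}$ on $\mathcal{H}_2$: $p_s=\eta_{\mathcal M}\mathrm{tr}[E_{\mathcal M}M_1]+\eta_{\mathcal N}\mathrm{tr}[E_{\mathcal N}N_1]$, $p_f=\eta_{\mathcal M}\mathrm{tr}[E_fM_1]+\eta_{\mathcal N}\mathrm{tr}[E_fN_1]$. Discrimination with fixed failure rate $p_f$ means maximizing $p_s$ over all tests (respectively POVMs) whose failure probability equals $p_f$. *)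

theory Defs
  imports "HOL-Analysis.Analysis"
begin

type_synonym qubit = "complex ^ 2"
type_synonym qubit_op = "complex ^ 2 ^ 2"

text \<open>Conjugate-linear in the first argument.\<close>
definition cinner :: "qubit \<Rightarrow> qubit \<Rightarrow> complex" where
  "cinner x y = (\<Sum>i\<in>UNIV. cnj (x $ i) * y $ i)"

definition ketbra :: "qubit \<Rightarrow> qubit \<Rightarrow> qubit_op" where
  "ketbra x y = (\<chi> i j. x $ i * cnj (y $ j))"

text \<open>Over the complex numbers, reality of the quadratic form already makes \<open>A\<close> Hermitian.\<close>
definition psd :: "qubit_op \<Rightarrow> bool" where
  "psd A \<longleftrightarrow> (\<forall>x. cinner x (A *v x) \<in> \<real> \<and> 0 \<le> Re (cinner x (A *v x)))"

datatype conclusion = ConcM | ConcN | Fail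

text \<open>The outcome index of a two-outcome measurement has type \<open>2\<close>, whose elements are \<open>1\<close> and \<open>2\<close>.\<close>
type_synonym measurement = "2 \<Rightarrow> qubit_op"
type_synonym test = "conclusion \<Rightarrow> 2 \<Rightarrow> qubit_op"
type_synonym state_povm = "conclusion \<Rightarrow> qubit_op"

definition is_test :: "test \<Rightarrow> bool" where
  "is_test H \<longleftrightarrow> (\<forall>c j. psd (H c j)) \<and>
     (\<exists>\<rho>. psd \<rho> \<and> trace \<rho> = 1 \<and> (\<forall>j. H ConcM j + H ConcN j + H Fail j = \<rho>))"

definition is_povm :: "state_povm \<Rightarrow> bool" where
  "is_povm E \<longleftrightarrow> (\<forall>c. psd (E c)) \<and> E ConcM + E ConcN + E Fail = mat 1"

text \<open>The traces below are real whenever the operators are positive semidefinite,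
  so taking the real part only serves to obtain a value of type \<^typ>\<open>real\<close>.\<close>

definition test_prob :: "test \<Rightarrow> measurement \<Rightarrow> conclusion \<Rightarrow> real" where
  "test_prob H A c = Re (\<Sum>j\<in>UNIV. trace (H c j ** A j))"

definition povm_prob :: "state_povm \<Rightarrow> qubit_op \<Rightarrow> conclusion \<Rightarrow> real" where
  "povm_prob E R c = Re (trace (E c ** R))"

definition test_success :: "real \<Rightarrow> real \<Rightarrow> measurement \<Rightarrow> measurement \<Rightarrow> test \<Rightarrow> real" where
  "test_success \<eta>M \<eta>N M N H = \<eta>M * test_prob H M ConcM + \<eta>N * test_prob H N ConcN"

definition test_failure :: "real \<Rightarrow> real \<Rightarrow> measurement \<Rightarrow> measurement \<Rightarrow> test \<Rightarrow> real" where
  "test_failure \<eta>M \<eta>N M N H = \<eta>M * test_prob H M Fail + \<eta>N * test_prob H N Fail"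

definition povm_success :: "real \<Rightarrow> real \<Rightarrow> qubit_op \<Rightarrow> qubit_op \<Rightarrow> state_povm \<Rightarrow> real" where
  "povm_success \<eta>M \<eta>N R S E = \<eta>M * povm_prob E R ConcM + \<eta>N * povm_prob E S ConcN"

definition povm_failure :: "real \<Rightarrow> real \<Rightarrow> qubit_op \<Rightarrow> qubit_op \<Rightarrow> state_povm \<Rightarrow> real" where
  "povm_failure \<eta>M \<eta>N R S E = \<eta>M * povm_prob E R Fail + \<eta>N * povm_prob E S Fail"

definition optimal_test ::
  "real \<Rightarrow> real \<Rightarrow> measurement \<Rightarrow> measurement \<Rightarrow> real \<Rightarrow> test \<Rightarrow> bool" where
  "optimal_test \<eta>M \<eta>N M N pf H \<longleftrightarrow>
     is_arg_max (test_success \<eta>M \<eta>N M N) (\<lambda>H. is_test H \<and> test_failure \<eta>M \<eta>N M N H = pf) H"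

definition optimal_povm ::
  "real \<Rightarrow> real \<Rightarrow> qubit_op \<Rightarrow> qubit_op \<Rightarrow> real \<Rightarrow> state_povm \<Rightarrow> bool" where
  "optimal_povm \<eta>M \<eta>N R S pf E \<longleftrightarrow>
     is_arg_max (povm_success \<eta>M \<eta>N R S) (\<lambda>E. is_povm E \<and> povm_failure \<eta>M \<eta>N R S E = pf) E"

text \<open>\<open>mat t\<close> is \<open>t\<close> times the identity matrix.\<close>
definition induced_test :: "state_povm \<Rightarrow> test" where
  "induced_test E c j =
     (if j = 1 then (1/2) *\<^sub>R E c else (1/2) *\<^sub>R (mat (trace (E c)) - E c))"

end

(*
The spin flip X -> tr(X) I - X is an involution of the qubit operators which is self-adjoint for
the trace form and, in dimension two, preserves positivity. It exchanges the two effects of each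
of the measurements considered. Hence folding the second outcome of a test back onto the first,
E_c = H_1 + flip(H_2), turns tests into POVMs without changing any probability (on M_1, N_1), and
the induced test is a right inverse of this folding. So both problems have the same set of
attainable pairs (success, failure); a maximum exists because the POVMs form a compact set.
*)

theory Submission
  imports Defs
begin

section \<open>The spin flip: positivity, linearity and self-adjointness\<close>

definition spin_flip :: "qubit_op \<Rightarrow> qubit_op" where
  "spin_flip A = mat (trace A) - A"

definition folded_povm :: "test \<Rightarrow> state_povm" where
  "folded_povm H c = H c 1 + spin_flip (H c 2)"

lemma trace_2: "trace (A :: qubit_op) = A $ 1 $ 1 + A $ 2 $ 2"
  by (simp add: trace_def sum_2)

lemma qubit_op_eq_iff:
  "(A :: qubit_op) = B \<longleftrightarrow>
     A $ 1 $ 1 = B $ 1 $ 1 \<and> A $ 1 $ 2 = B $ 1 $ 2 \<and> A $ 2 $ 1 = B $ 2 $ 1 \<and> A $ 2 $ 2 = B $ 2 $ 2"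
  by (auto simp: vec_eq_iff forall_2)

lemma cinner_matrix_vector:
  "cinner x (A *v x) =
     cnj (x $ 1) * A $ 1 $ 1 * x $ 1 + cnj (x $ 1) * A $ 1 $ 2 * x $ 2 +
     cnj (x $ 2) * A $ 2 $ 1 * x $ 1 + cnj (x $ 2) * A $ 2 $ 2 * x $ 2"
  by (simp add: cinner_def matrix_vector_mult_def sum_2 algebra_simps)

lemma psd_add:
  assumes "psd A" "psd B"
  shows "psd (A + B)"
proof -
  have "cinner x ((A + B) *v x) = cinner x (A *v x) + cinner x (B *v x)" for x
    by (simp only: cinner_matrix_vector vector_add_component) (simp add: algebra_simps)
  then show ?thesis using assms by (simp add: psd_def)
qed

lemma psd_scaleR:
  assumes "psd A" "0 \<le> r"
  shows "psd (r *\<^sub>R A)"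
proof -
  have "cinner x ((r *\<^sub>R A) *v x) = r *\<^sub>R cinner x (A *v x)" for x
    by (simp add: cinner_matrix_vector algebra_simps)
  then show ?thesis using assms by (simp add: psd_def complex_is_Real_iff)
qed

text \<open>In dimension two the complement of a line is a line: for \<open>y\<close> orthogonal to
  \<open>x\<close> and of the same norm, the quadratic forms of \<open>A\<close> at \<open>x\<close>
  and at \<open>y\<close> add up to \<open>trace A\<close> times the squared norm of
  \<open>x\<close>. So flipping \<open>A\<close> moves its form from \<open>x\<close> to
  \<open>y\<close>.\<close>

lemma psd_spin_flip:
  assumes "psd A"
  shows "psd (spin_flip A)"
proof -
  have "cinner x (spin_flip A *v x) = cinner y (A *v y)"
    if "y = vector [- cnj (x $ 2), cnj (x $ 1)]" for x y
    unfolding that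
    by (simp only: cinner_matrix_vector spin_flip_def vector_minus_component)
       (simp add: trace_2 mat_def algebra_simps)
  then show ?thesis using assms unfolding psd_def by metis
qed

lemma psd_mat: "0 \<le> r \<Longrightarrow> psd (mat (complex_of_real r))"
  by (simp add: psd_def cinner_matrix_vector mat_def complex_is_Real_iff algebra_simps)

lemma trace_scaleR: "trace (r *\<^sub>R (A :: qubit_op)) = r *\<^sub>R trace A"
  by (simp add: trace_2 scaleR_add_right)

lemma spin_flip_add: "spin_flip (A + B) = spin_flip A + spin_flip B"
  by (simp add: qubit_op_eq_iff spin_flip_def trace_2 mat_def)

lemma spin_flip_scaleR: "spin_flip (r *\<^sub>R A) = r *\<^sub>R spin_flip A"
  by (simp add: qubit_op_eq_iff spin_flip_def trace_2 mat_def algebra_simps)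

lemma spin_flip_spin_flip: "spin_flip (spin_flip A) = A"
  by (simp add: qubit_op_eq_iff spin_flip_def trace_2 mat_def)

lemma spin_flip_mat_1: "spin_flip (mat 1) = mat 1"
  by (simp add: qubit_op_eq_iff spin_flip_def trace_2 mat_def)

text \<open>Both sides equal \<open>trace A * trace B - trace (A ** B)\<close>.\<close>

lemma trace_spin_flip_mult: "trace (spin_flip A ** B) = trace (A ** spin_flip B)"
  by (simp add: spin_flip_def trace_2 mat_def matrix_matrix_mult_def sum_2 algebra_simps)

section \<open>Passing between tests and POVMs\<close>

lemma is_povm_folded_povm:
  assumes "is_test H"
  shows "is_povm (folded_povm H)"
proof -
  from assms obtain \<rho> where psd: "psd (H c j)" and \<rho>: "trace \<rho> = 1"
      "H ConcM j + H ConcN j + H Fail j = \<rho>" for c j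
    unfolding is_test_def by blast
  have "folded_povm H ConcM + folded_povm H ConcN + folded_povm H Fail =
      (H ConcM 1 + H ConcN 1 + H Fail 1) + spin_flip (H ConcM 2 + H ConcN 2 + H Fail 2)"
    by (simp add: folded_povm_def spin_flip_add)
  \<comment> \<open>Both outcomes share the same \<open>\<rho>\<close>, so the sum is
    \<open>\<rho> + spin_flip \<rho>\<close>, which is \<open>trace \<rho>\<close> times the
    identity.\<close>
  also have "\<dots> = mat 1" by (simp only: \<rho>) (simp add: spin_flip_def \<rho>(1))
  finally show ?thesis
    using psd by (simp add: is_povm_def folded_povm_def psd_add psd_spin_flip)
qed

lemma induced_test_alt:
  "induced_test E c j = (1/2) *\<^sub>R (if j = 1 then E c else spin_flip (E c))"
  by (simp add: induced_test_def spin_flip_def)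

lemma is_test_induced_test:
  assumes "is_povm E"
  shows "is_test (induced_test E)"
  unfolding is_test_def
proof (intro conjI exI allI)
  show "psd (induced_test E c j)" for c j
    using assms by (auto simp: is_povm_def induced_test_alt intro!: psd_scaleR psd_spin_flip)
  have sum: "E ConcM + E ConcN + E Fail = mat 1"
    using assms by (simp add: is_povm_def)
  show "induced_test E ConcM j + induced_test E ConcN j + induced_test E Fail j
      = (1/2) *\<^sub>R mat 1" for j
    \<comment> \<open>Reading \<open>sum\<close> from right to left turns
      \<open>spin_flip_mat_1\<close> into invariance of the total effect under the flip, so both
      outcomes yield the maximally mixed state.\<close>
    using spin_flip_mat_1
    by (simp add: induced_test_alt flip: sum scaleR_add_right spin_flip_add)
  show "psd ((1/2) *\<^sub>R mat 1)"
    using psd_mat[of 1] by (intro psd_scaleR) auto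
  show "trace ((1/2) *\<^sub>R (mat 1 :: qubit_op)) = 1"
    by (simp only: trace_scaleR) (simp add: trace_2 mat_def scaleR_conv_of_real)
qed

lemma folded_povm_induced_test: "folded_povm (induced_test E) = E"
  by (rule ext)
     (simp add: folded_povm_def induced_test_alt spin_flip_scaleR spin_flip_spin_flip
        flip: scaleR_add_left)

text \<open>Self-adjointness moves the flip from the effect \<open>A 2\<close> onto the test
  operator \<open>H c 2\<close>, leaving \<open>A 1\<close> as the only operator tested.\<close>

lemma test_prob_eq_povm_prob:
  assumes "A 2 = spin_flip (A 1)"
  shows "test_prob H A c = povm_prob (folded_povm H) (A 1) c"
proof -
  have "trace ((X + Y) ** B) = trace (X ** B) + trace (Y ** B)" for X Y B :: qubit_op
    by (simp add: trace_2 matrix_matrix_mult_def sum_2 algebra_simps)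
  then show ?thesis
    by (simp add: test_prob_def povm_prob_def folded_povm_def sum_2 assms trace_spin_flip_mult)
qed

context
  fixes \<eta>M \<eta>N :: real and M N :: measurement
  assumes flip: "M 2 = spin_flip (M 1)" "N 2 = spin_flip (N 1)"
begin

lemma test_success_eq:
  "test_success \<eta>M \<eta>N M N H = povm_success \<eta>M \<eta>N (M 1) (N 1) (folded_povm H)"
  by (simp add: test_success_def povm_success_def flip test_prob_eq_povm_prob)

lemma test_failure_eq:
  "test_failure \<eta>M \<eta>N M N H = povm_failure \<eta>M \<eta>N (M 1) (N 1) (folded_povm H)"
  by (simp add: test_failure_def povm_failure_def flip test_prob_eq_povm_prob)

text \<open>A test beating \<open>induced_test E\<close> at the same failure rate would fold to a
  POVM beating \<open>E\<close>.\<close>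

lemma optimal_test_induced_test:
  assumes "optimal_povm \<eta>M \<eta>N (M 1) (N 1) pf E"
  shows "optimal_test \<eta>M \<eta>N M N pf (induced_test E)"
  using assms
  by (auto simp: optimal_test_def optimal_povm_def is_arg_max_def test_success_eq test_failure_eq
      folded_povm_induced_test is_test_induced_test dest: is_povm_folded_povm)

end

section \<open>Compactness of the POVMs and existence of an optimum\<close>

lemma closed_psd: "closed {A. psd A}"
  unfolding psd_def complex_is_Real_iff cinner_matrix_vector
  by (intro closed_Collect_all closed_Collect_conj closed_Collect_eq closed_Collect_le
      continuous_intros)

lemma psd_norm_entry_le_trace:
  assumes "psd A"
  shows "norm (A $ i $ j) \<le> Re (trace A)"
proof -
  have q: "Im (cinner x (A *v x)) = 0" "0 \<le> Re (cinner x (A *v x))" for x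
    using assms by (auto simp: psd_def complex_is_Real_iff)
  \<comment> \<open>Polarization: the basis vectors isolate the diagonal entries, the vectors with
    second entry 1 or -1 control the real parts off the diagonal, and those with second entry
    \<open>\<i>\<close> or \<open>- \<i>\<close> the imaginary parts.\<close>
  note q' = q[of "vector [1, 0]"] q[of "vector [0, 1]"] q[of "vector [1, 1]"] q[of "vector [1, -1]"]
    q[of "vector [1, \<i>]"] q[of "vector [1, - \<i>]"]
  note simps = cinner_matrix_vector algebra_simps
  have diag: "Im (A $ 1 $ 1) = 0" "0 \<le> Re (A $ 1 $ 1)" "Im (A $ 2 $ 2) = 0" "0 \<le> Re (A $ 2 $ 2)"
    using q'(1-4) by (simp_all add: simps)
  have herm: "Re (A $ 1 $ 2) = Re (A $ 2 $ 1)" "Im (A $ 1 $ 2) = - Im (A $ 2 $ 1)"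
    using q'(5-12) diag by (simp_all add: simps)
  have "norm (A $ 1 $ 2) \<le> Re (A $ 1 $ 1) + Re (A $ 2 $ 2)"
  proof -
    have "\<bar>2 * Re (A $ 1 $ 2)\<bar> \<le> Re (A $ 1 $ 1) + Re (A $ 2 $ 2)"
      using q'(5-8) herm by (simp add: simps)
    moreover have "\<bar>2 * Im (A $ 1 $ 2)\<bar> \<le> Re (A $ 1 $ 1) + Re (A $ 2 $ 2)"
      using q'(9-12) herm by (simp add: simps)
    ultimately show ?thesis
      \<comment> \<open>Each of the real and imaginary parts is at most half the trace in absolute
        value, so even their sum stays below the trace.\<close>
      using cmod_le[of "A $ 1 $ 2"] by linarith
  qed
  moreover have "norm (A $ 2 $ 1) = norm (A $ 1 $ 2)"
    by (simp add: cmod_def herm)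
  moreover have "norm (A $ 1 $ 1) = Re (A $ 1 $ 1)" "norm (A $ 2 $ 2) = Re (A $ 2 $ 2)"
    using diag by (simp_all add: cmod_def)
  ultimately show ?thesis
    using exhaust_2[of i] exhaust_2[of j] diag by (auto simp: trace_2)
qed

text \<open>The factor 4 counts the entries, each of which is bounded by the trace.\<close>

lemma psd_norm_le:
  assumes "psd A"
  shows "norm A \<le> 4 * Re (trace A)"
proof -
  have "norm A \<le> (\<Sum>i\<in>UNIV. \<Sum>j\<in>UNIV. norm (A $ i $ j))"
    unfolding norm_vec_def[of A]
    by (rule order_trans[OF L2_set_le_sum]) (auto simp: norm_vec_def intro!: sum_mono L2_set_le_sum)
  also have "\<dots> \<le> 4 * Re (trace A)"
    using psd_norm_entry_le_trace[OF assms] by (simp add: sum_2) (smt (verit))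
  finally show ?thesis .
qed

text \<open>A POVM is encoded by a triple of operators, as the function type \<^typ>\<open>state_povm\<close> has no
  metric structure.\<close>

definition povm_of_triple :: "qubit_op \<times> qubit_op \<times> qubit_op \<Rightarrow> state_povm" where
  "povm_of_triple t c = (case c of ConcM \<Rightarrow> fst t | ConcN \<Rightarrow> fst (snd t) | Fail \<Rightarrow> snd (snd t))"

lemma povm_of_triple_surj: "\<exists>t. povm_of_triple t = E"
  by (rule exI[of _ "(E ConcM, E ConcN, E Fail)"])
     (auto simp: povm_of_triple_def fun_eq_iff split: conclusion.split)

lemma all_conclusion: "(\<forall>c. P c) \<longleftrightarrow> P ConcM \<and> P ConcN \<and> P Fail"
  by (metis conclusion.exhaust)

lemma continuous_on_povm_prob: "continuous_on S (\<lambda>t. povm_prob (povm_of_triple t) R c)"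
  by (cases c)
     (auto simp: povm_prob_def povm_of_triple_def trace_2 matrix_matrix_mult_def sum_2
        intro!: continuous_intros)

lemma compact_povm: "compact {t. is_povm (povm_of_triple t)}"
proof -
  \<comment> \<open>The effects have nonnegative traces with sum 2, so each trace is at most 2 and
    \<open>psd_norm_le\<close> gives the radius 8.\<close>
  let ?K = "{A. psd A \<and> norm A \<le> 8}"
  have "?K = {A. psd A} \<inter> cball 0 8" by auto
  then have K: "compact ?K" using closed_psd by (simp add: closed_Int_compact)
  have bound: "norm (E c) \<le> 8" if "is_povm E" for E c
  proof -
    have "trace (E ConcM + E ConcN + E Fail) = 2"
      using that by (simp add: is_povm_def trace_2 mat_def)
    then have "Re (trace (E ConcM)) + Re (trace (E ConcN)) + Re (trace (E Fail)) = 2"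
      by (simp add: trace_add flip: plus_complex.sel)
    moreover have psd: "psd (E c)" for c using that by (simp add: is_povm_def)
    moreover have "0 \<le> Re (trace (E c))" for c
      using psd_norm_entry_le_trace[OF psd[of c], of 1 1] norm_ge_zero order_trans by blast
    ultimately have "Re (trace (E c)) \<le> 2"
      by (cases c) (smt (verit))+
    then show ?thesis using psd_norm_le[OF psd[of c]] by linarith
  qed
  have "{t. is_povm (povm_of_triple t)} =
      (?K \<times> ?K \<times> ?K) \<inter> {t. fst t + fst (snd t) + snd (snd t) = mat 1}" (is "?L = ?R")
  proof
    show "?L \<subseteq> ?R"
    proof
      fix t assume t: "t \<in> ?L"
      then have "norm (povm_of_triple t c) \<le> 8" for c using bound by simp
      from this[of ConcM] this[of ConcN] this[of Fail] t show "t \<in> ?R"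
        by (auto simp: is_povm_def all_conclusion povm_of_triple_def mem_Times_iff)
    qed
  qed (auto simp: is_povm_def all_conclusion povm_of_triple_def)
  moreover have "closed {t :: qubit_op \<times> qubit_op \<times> qubit_op. fst t + fst (snd t) + snd (snd t) = mat 1}"
    by (intro closed_Collect_eq continuous_intros)
  ultimately show ?thesis
    using K by (simp add: compact_Int_closed compact_Times)
qed

lemma optimal_povm_exists:
  assumes "trace R = 1" "trace S = 1" "\<eta>M + \<eta>N = 1" "pf \<in> {0..1}"
  shows "\<exists>E. optimal_povm \<eta>M \<eta>N R S pf E"
proof -
  let ?F = "{t. is_povm (povm_of_triple t)} \<inter> {t. povm_failure \<eta>M \<eta>N R S (povm_of_triple t) = pf}"
  have "closed {t. povm_failure \<eta>M \<eta>N R S (povm_of_triple t) = pf}"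
    unfolding povm_failure_def
    by (intro closed_Collect_eq continuous_intros continuous_on_povm_prob)
  then have "compact ?F" by (intro compact_Int_closed compact_povm)
  \<comment> \<open>Feasibility: ignoring the state and declaring failure with probability
    \<open>pf\<close> has exactly this failure rate, since the states have trace 1 and the priors
    sum to 1.\<close>
  moreover have "(mat (complex_of_real (1 - pf)), mat (complex_of_real 0), mat (complex_of_real pf)) \<in> ?F"
  proof -
    have [simp]: "trace (mat c ** A) = c * trace A" for c :: complex and A :: qubit_op
      by (simp add: trace_2 matrix_matrix_mult_def mat_def sum_2 algebra_simps)
    have "mat (complex_of_real (1 - pf)) + mat (complex_of_real 0) + mat (complex_of_real pf)
        = (mat 1 :: qubit_op)"
      by (simp add: qubit_op_eq_iff mat_def)
    then show ?thesis
      using assms psd_mat[of pf] psd_mat[of "1 - pf"] psd_mat[of 0]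
      by (simp add: is_povm_def all_conclusion povm_of_triple_def povm_failure_def povm_prob_def
          flip: distrib_right)
  qed
  moreover have "continuous_on ?F (\<lambda>t. povm_success \<eta>M \<eta>N R S (povm_of_triple t))"
    unfolding povm_success_def by (intro continuous_intros continuous_on_povm_prob)
  ultimately obtain t where t: "t \<in> ?F"
    and max: "\<And>u. u \<in> ?F \<Longrightarrow> povm_success \<eta>M \<eta>N R S (povm_of_triple u)
                 \<le> povm_success \<eta>M \<eta>N R S (povm_of_triple t)"
    using continuous_attains_sup[of ?F] by (metis empty_iff)
  have "optimal_povm \<eta>M \<eta>N R S pf (povm_of_triple t)"
    unfolding optimal_povm_def is_arg_max_linorder
  proof (intro conjI allI impI)
    fix E assume "is_povm E \<and> povm_failure \<eta>M \<eta>N R S E = pf"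
    moreover obtain u where "povm_of_triple u = E" using povm_of_triple_surj by blast
    ultimately show "povm_success \<eta>M \<eta>N R S E \<le> povm_success \<eta>M \<eta>N R S (povm_of_triple t)"
      using max[of u] by auto
  qed (use t in auto)
  then show ?thesis by blast
qed

section \<open>Noisy qubit measurements\<close>

lemma cinner_self: "cinner x x = complex_of_real ((norm x)\<^sup>2)"
  by (simp add: cinner_def norm_vec_def L2_set_def sum_2 mult.commute flip: complex_norm_square)

text \<open>With \<open>x\<close> and \<open>y\<close> as the columns of \<open>U\<close> and
  \<open>V\<close> its adjoint, orthonormality says \<open>V ** U = mat 1\<close> and completeness
  says \<open>U ** V = mat 1\<close>; for square matrices these are equivalent.\<close>

lemma ketbra_orthonormal_sum:
  assumes "norm x = 1" "norm y = 1" "cinner x y = 0"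
  shows "ketbra x x + ketbra y y = mat 1"
proof -
  define U :: qubit_op where "U = (\<chi> i j. if j = 1 then x $ i else y $ i)"
  define V :: qubit_op where "V = (\<chi> i j. if i = 1 then cnj (x $ j) else cnj (y $ j))"
  have "cinner y x = cnj (cinner x y)"
    by (simp add: cinner_def sum_2 mult.commute)
  then have "V ** U = mat 1"
    using assms cinner_self[of x] cinner_self[of y]
    by (simp add: qubit_op_eq_iff U_def V_def matrix_matrix_mult_def mat_def flip: cinner_def)
  then have "U ** V = mat 1" by (simp add: matrix_left_right_inverse)
  moreover have "U ** V = ketbra x x + ketbra y y"
    by (simp add: qubit_op_eq_iff U_def V_def matrix_matrix_mult_def ketbra_def sum_2)
  ultimately show ?thesis by simp
qed

lemma trace_ketbra_self: "trace (ketbra x x) = complex_of_real ((norm x)\<^sup>2)"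
  unfolding cinner_self[symmetric] by (simp add: trace_def ketbra_def cinner_def mult.commute)

text \<open>By completeness the flip exchanges the two projections; being linear and fixing the
  identity, it respects the white noise.\<close>

lemma noisy_qubit_measurement:
  assumes "norm x = 1" "norm y = 1" "cinner x y = 0"
    and "A 1 = t *\<^sub>R ketbra x x + ((1 - t) / 2) *\<^sub>R mat 1"
    and "A 2 = t *\<^sub>R ketbra y y + ((1 - t) / 2) *\<^sub>R mat 1"
  shows "trace (A 1) = 1" "A 2 = spin_flip (A 1)"
proof -
  have "trace (ketbra x x) = 1" using assms(1) by (simp add: trace_ketbra_self)
  moreover have "ketbra y y = mat 1 - ketbra x x"
    using ketbra_orthonormal_sum[OF assms(1-3)] by (simp add: algebra_simps)
  ultimately have "spin_flip (ketbra x x) = ketbra y y" by (simp add: spin_flip_def)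
  then show "A 2 = spin_flip (A 1)"
    by (simp add: assms(4,5) spin_flip_add spin_flip_scaleR spin_flip_mat_1)
  have "trace (mat 1 :: qubit_op) = 2" by (simp add: trace_2 mat_def)
  then show "trace (A 1) = 1"
    using \<open>trace (ketbra x x) = 1\<close>
    by (simp add: assms(4) trace_add trace_scaleR) (simp add: scaleR_conv_of_real field_simps)
qed

theorem mainTheorem6:
  fixes \<phi> \<phi>p \<psi> \<psi>p :: qubit
    and \<mu> \<nu> \<eta>M \<eta>N pf :: real
    and M N :: measurement
  assumes "norm \<phi> = 1" "norm \<phi>p = 1" "cinner \<phi> \<phi>p = 0"
    and "norm \<psi> = 1" "norm \<psi>p = 1" "cinner \<psi> \<psi>p = 0"
    and "\<mu> \<in> {0..1}" "\<nu> \<in> {0..1}"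
    and "M 1 = \<mu> *\<^sub>R ketbra \<phi> \<phi> + ((1 - \<mu>) / 2) *\<^sub>R mat 1"
    and "M 2 = \<mu> *\<^sub>R ketbra \<phi>p \<phi>p + ((1 - \<mu>) / 2) *\<^sub>R mat 1"
    and "N 1 = \<nu> *\<^sub>R ketbra \<psi> \<psi> + ((1 - \<nu>) / 2) *\<^sub>R mat 1"
    and "N 2 = \<nu> *\<^sub>R ketbra \<psi>p \<psi>p + ((1 - \<nu>) / 2) *\<^sub>R mat 1"
    and "0 \<le> \<eta>M" "0 \<le> \<eta>N" "\<eta>M + \<eta>N = 1"
    and "pf \<in> {0..1}"
  shows "(\<exists>p. (\<exists>H. optimal_test \<eta>M \<eta>N M N pf H \<and> test_success \<eta>M \<eta>N M N H = p) \<and>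
              (\<exists>E. optimal_povm \<eta>M \<eta>N (M 1) (N 1) pf E \<and> povm_success \<eta>M \<eta>N (M 1) (N 1) E = p)) \<and>
         (\<forall>E. optimal_povm \<eta>M \<eta>N (M 1) (N 1) pf E \<longrightarrow>
              optimal_test \<eta>M \<eta>N M N pf (induced_test E))"
proof (intro conjI allI impI)
  note M = noisy_qubit_measurement[OF assms(1-3,9,10)]
  note N = noisy_qubit_measurement[OF assms(4-6,11,12)]
  show "optimal_test \<eta>M \<eta>N M N pf (induced_test E)"
    if "optimal_povm \<eta>M \<eta>N (M 1) (N 1) pf E" for E
    using optimal_test_induced_test[OF M(2) N(2) that] .
  obtain E where E: "optimal_povm \<eta>M \<eta>N (M 1) (N 1) pf E"
    using optimal_povm_exists[OF M(1) N(1) assms(15,16)] by blast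
  \<comment> \<open>Folding undoes \<open>induced_test\<close>, so \<open>E\<close> and its induced
    test witness the same optimal value.\<close>
  moreover have "test_success \<eta>M \<eta>N M N (induced_test E) = povm_success \<eta>M \<eta>N (M 1) (N 1) E"
    using test_success_eq[OF M(2) N(2)] by (simp add: folded_povm_induced_test)
  ultimately show "\<exists>p. (\<exists>H. optimal_test \<eta>M \<eta>N M N pf H \<and> test_success \<eta>M \<eta>N M N H = p) \<and>
      (\<exists>E. optimal_povm \<eta>M \<eta>N (M 1) (N 1) pf E \<and> povm_success \<eta>M \<eta>N (M 1) (N 1) E = p)"
    using optimal_test_induced_test[OF M(2) N(2) E] by blast
qed

end
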